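(* Let $R$ be an aperiodic two-step rule. For each step direction $\theta\in\{e,n,w,s\}$ the upper-half-plane generating function $H_\theta(x,y)$ satisfies a functional equation of the form $$H_\theta(x,y)=C_\theta(x,y)+B_\theta(x,y)H_\theta(x,y)-D_\theta(x,y)H^*(x,0),$$ where - $B_\theta$ is the generating function of walks (in the full plane) obeying $R$ which start with a step from $f(\theta)$ and contain only one $\theta$ step, being their last step; - $C_\theta$ is the generating function of walks (in the full plane) obeying $R$ which do not start with a south step and contain only one $\theta$ step, being their last step; - $D_\theta$ is the generating function of walks (in the full plane) obeying $R$ which start with a south step and contain only one $\theta$ step, being their last step; - $H^*(x,y)=\sum_{\phi\in p(s)}H_\phi(x,y)$ is the generating function of upper-half-plane walks ending with a step which can be followed by a south step.
   Context: Steps on $\mathbb Z^2$: east $(1,0)$, north $(0,1)$, west $(-1,0)$, south $(0,-1)$, abbreviated $e,n,w,s$. A two-step rule is a map $R:\{e,n,w,s\}^2\to\{0,1\}$; $R(i,j)=1$ means a step of type $i$ may be immediately followed by one of type $j$. Its transfer matrix is $T=(R(i,j))_{i,j}$. The rule is aperiodic if there is $k\ge1$ with $(T^k)_{ij}>0$ for all $i,j$. A walk obeying $R$ is a nonempty finite sequence of steps, starting at the origin, with arbitrary first step and with $R(i,j)=1$ for each consecutive pair of steps $(i,j)$. $f(\theta)=\{j:R(\theta,j)=1\}$ and $p(\theta)=\{i:R(i,\theta)=1\}$. The generating function of a class of walks is $\sum t^m x^a y^b$ over walks in the class, where $m$ is the length and $(a,b)$ the endpoint (the walk starting at the origin). $H_\theta(x,y)\equiv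 H_\theta(t;x,y)$ is the generating function of walks obeying $R$, starting at the origin, staying in the upper half plane $\{(a,b):b\ge0\}$, whose last step is $\theta$. $H^*(x,0)$ denotes $H^*(x,y)$ evaluated at $y=0$ (so it counts such walks ending on the $\mathbf x$-axis). *)

theory Defs
  imports
    "HOL-Analysis.Finite_Cartesian_Product"
    "HOL-Library.Poly_Mapping"
    "HOL-Library.Product_Plus"
    "HOL-Computational_Algebra.Formal_Power_Series"
begin

section \<open>Two-step rules and walks\<close>

datatype step = East | North | West | South

lemma UNIV_step: "(UNIV :: step set) = {East, North, West, South}"
  using step.exhaust by blast

instance step :: finite
  by standard (simp add: UNIV_step)

fun step_vec :: "step \<Rightarrow> int \<times> int" where
  "step_vec East = (1, 0)"
| "step_vec North = (0, 1)"
| "step_vec West = (-1, 0)"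
| "step_vec South = (0, -1)"

text \<open>\<open>R i j\<close> means that a step \<open>i\<close> may be immediately followed by a step \<open>j\<close>.\<close>

type_synonym two_step_rule = "step \<Rightarrow> step \<Rightarrow> bool"

definition transfer_matrix :: "two_step_rule \<Rightarrow> nat ^ step ^ step" where
  "transfer_matrix R = (\<chi> i j. of_bool (R i j))"

text \<open>The operation \<open>^\<close> on the vector type acts componentwise, so the matrix power is written
  as an iterated matrix product.\<close>

definition aperiodic :: "two_step_rule \<Rightarrow> bool" where
  "aperiodic R \<longleftrightarrow>
     (\<exists>k\<ge>1. \<forall>i j. vec_nth (vec_nth ((((**) (transfer_matrix R)) ^^ k) (mat 1)) i) j > 0)"

definition followers :: "two_step_rule \<Rightarrow> step \<Rightarrow> step set" where
  "followers R \<theta> = {j. R \<theta> j}"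

definition predecessors :: "two_step_rule \<Rightarrow> step \<Rightarrow> step set" where
  "predecessors R \<theta> = {i. R i \<theta>}"

definition walks :: "two_step_rule \<Rightarrow> step list set" where
  "walks R = {w. w \<noteq> [] \<and> successively R w}"

definition endpoint :: "step list \<Rightarrow> int \<times> int" where
  "endpoint w = sum_list (map step_vec w)"

definition in_upper_half_plane :: "step list \<Rightarrow> bool" where
  "in_upper_half_plane w \<longleftrightarrow> (\<forall>k\<le>length w. snd (endpoint (take k w)) \<ge> 0)"


section \<open>Generating functions\<close>

text \<open>The Laurent monomial \<open>x\<^sup>a y\<^sup>b\<close> is \<open>Poly_Mapping.single (a, b) 1\<close>. Generating
  functions are formal power series in \<open>t\<close> over the ring of Laurent polynomials in \<open>x, y\<close>.\<close>

type_synonym laurent_poly = "(int \<times> int) \<Rightarrow>\<^sub>0 int"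

definition genfun :: "step list set \<Rightarrow> laurent_poly fps" where
  "genfun W = Abs_fps (\<lambda>m. \<Sum>w | w \<in> W \<and> length w = m. Poly_Mapping.single (endpoint w) 1)"

text \<open>Evaluation at \<open>y = 0\<close> keeps exactly the monomials \<open>x\<^sup>a y\<^sup>0\<close>. It is meaningful only for
  series without negative powers of \<open>y\<close>, such as those counting upper half plane walks.\<close>

definition eval_y0 :: "laurent_poly fps \<Rightarrow> laurent_poly fps" where
  "eval_y0 F = Abs_fps (\<lambda>m. Poly_Mapping.mapp (\<lambda>(a, b) c. if b = 0 then c else 0) (fps_nth F m))"

definition H_gf :: "two_step_rule \<Rightarrow> step \<Rightarrow> laurent_poly fps" where
  "H_gf R \<theta> = genfun {w \<in> walks R. in_upper_half_plane w \<and> last w = \<theta>}"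

definition Hstar_gf :: "two_step_rule \<Rightarrow> laurent_poly fps" where
  "Hstar_gf R = (\<Sum>\<phi>\<in>predecessors R South. H_gf R \<phi>)"

definition only_at_end :: "step \<Rightarrow> step list \<Rightarrow> bool" where
  "only_at_end \<theta> w \<longleftrightarrow> w \<noteq> [] \<and> last w = \<theta> \<and> count_list w \<theta> = 1"

definition B_gf :: "two_step_rule \<Rightarrow> step \<Rightarrow> laurent_poly fps" where
  "B_gf R \<theta> = genfun {w \<in> walks R. hd w \<in> followers R \<theta> \<and> only_at_end \<theta> w}"

definition C_gf :: "two_step_rule \<Rightarrow> step \<Rightarrow> laurent_poly fps" where
  "C_gf R \<theta> = genfun {w \<in> walks R. hd w \<noteq> South \<and> only_at_end \<theta> w}"

definition D_gf :: "two_step_rule \<Rightarrow> step \<Rightarrow> laurent_poly fps" where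
  "D_gf R \<theta> = genfun {w \<in> walks R. hd w = South \<and> only_at_end \<theta> w}"


section \<open>Basic facts\<close>

lemma finite_walks_of_length: "finite {w :: step list. w \<in> W \<and> length w = m}"
  by (rule finite_subset[OF _ finite_lists_length_eq[of UNIV m]]) auto

lemma lookup_genfun:
  "Poly_Mapping.lookup (fps_nth (genfun W) m) k = int (card {w \<in> W. length w = m \<and> endpoint w = k})"
proof -
  have "Poly_Mapping.lookup (fps_nth (genfun W) m) k =
      (\<Sum>w | w \<in> W \<and> length w = m. if k = endpoint w then 1 else 0)"
    by (simp add: genfun_def lookup_sum lookup_single when_def eq_commute[of k])
  also have "\<dots> = (\<Sum>w\<in>{w \<in> {w. w \<in> W \<and> length w = m}. k = endpoint w}. 1)"
    by (rule sum.inter_filter[symmetric]) (rule finite_walks_of_length)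
  also have "{w \<in> {w. w \<in> W \<and> length w = m}. k = endpoint w}
      = {w \<in> W. length w = m \<and> endpoint w = k}"
    by auto
  finally show ?thesis by simp
qed

lemma eval_y0_genfun: "eval_y0 (genfun W) = genfun {w \<in> W. snd (endpoint w) = 0}"
proof (rule fps_ext, rule poly_mapping_eqI)
  fix m :: nat and k :: "int \<times> int"
  obtain a b where k: "k = (a, b)" by (cases k)
  have "Poly_Mapping.lookup (fps_nth (eval_y0 (genfun W)) m) k =
      (if b = 0 then Poly_Mapping.lookup (fps_nth (genfun W) m) k else 0)"
    by (auto simp: eval_y0_def lookup_mapp k when_def in_keys_iff)
  also have "\<dots> = Poly_Mapping.lookup (fps_nth (genfun {w \<in> W. snd (endpoint w) = 0}) m) k"
  proof (cases "b = 0")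
    case True
    then have "{w \<in> W. length w = m \<and> endpoint w = k} =
        {w \<in> {w \<in> W. snd (endpoint w) = 0}. length w = m \<and> endpoint w = k}"
      by (auto simp: k)
    with True show ?thesis by (simp only: lookup_genfun if_True refl)
  next
    case False
    then have "{w \<in> {w \<in> W. snd (endpoint w) = 0}. length w = m \<and> endpoint w = k} = {}"
      by (auto simp: k)
    with False show ?thesis by (simp only: lookup_genfun if_False card.empty of_nat_0)
  qed
  finally show "Poly_Mapping.lookup (fps_nth (eval_y0 (genfun W)) m) k =
      Poly_Mapping.lookup (fps_nth (genfun {w \<in> W. snd (endpoint w) = 0}) m) k" .
qed

end

theory Submission
  imports Defs
begin

text \<open>
  The equation is an identity between sets of words, read off in generating functions.
  Write \<open>W \<frown> W'\<close> for the set of all concatenations. For the words counted by \<open>H\<^sub>\<theta>\<close>, \<open>B\<^sub>\<theta>\<close>, \<open>C\<^sub>\<theta>\<close>,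
  \<open>D\<^sub>\<theta>\<close> and for the set \<open>S\<close> of half plane walks that end on the \<open>x\<close>-axis and can be followed by a
  south step, the identity is
  \<open>C\<^sub>\<theta> \<union> (H\<^sub>\<theta> \<frown> B\<^sub>\<theta>) = H\<^sub>\<theta> \<union> (S \<frown> D\<^sub>\<theta>)\<close> with both unions disjoint (\<open>cut_identity\<close>).

  Indeed, both sides describe the walks ending in \<open>\<theta>\<close> that do not start with a south step and that
  stay in the half plane up to their last \<open>\<theta>\<close> before the final step, if there is one. The left side
  sorts them by whether there is such an earlier \<open>\<theta>\<close>, and cuts there if there is. The right
  side sorts them by whether the walk ever leaves the half plane, and cuts just before the
  first step that leaves it. This step is a south step from the axis, and the excursion beyond it
  meets \<open>\<theta>\<close> only at its end.

  Concatenation multiplies the monomials \<open>t\<^sup>m x\<^sup>a y\<^sup>b\<close>, so a set of concatenations is counted by the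
  product as soon as the cut can be recovered from the word (\<open>genfun_mult\<close>). The cut is the last
  earlier \<open>\<theta>\<close> on the left (\<open>inj_on_append_only_at_end\<close>) and the first exit on the right
  (\<open>inj_on_append_first_exit\<close>).
\<close>

section \<open>Generating functions of unions and concatenations\<close>

lemma genfun_nth: "fps_nth (genfun W) m =
    (\<Sum>w | w \<in> W \<and> length w = m. Poly_Mapping.single (endpoint w) 1)"
  by (simp add: genfun_def)

lemma genfun_Un_disjoint:
  assumes "A \<inter> B = {}"
  shows "genfun (A \<union> B) = genfun A + genfun B"
proof (rule fps_ext)
  fix m
  have "{w. w \<in> A \<union> B \<and> length w = m} = {w. w \<in> A \<and> length w = m} \<union> {w. w \<in> B \<and> length w = m}"
    by auto
  then show "fps_nth (genfun (A \<union> B)) m = fps_nth (genfun A + genfun B) m"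
    unfolding genfun_nth fps_add_nth
    using assms by (simp only:) (intro sum.union_disjoint finite_walks_of_length, auto)
qed

lemma genfun_empty: "genfun {} = 0"
  by (rule fps_ext) (simp add: genfun_nth)

lemma genfun_UN_disjoint:
  assumes "finite I" and "\<And>i j. i \<in> I \<Longrightarrow> j \<in> I \<Longrightarrow> i \<noteq> j \<Longrightarrow> W i \<inter> W j = {}"
  shows "genfun (\<Union>i\<in>I. W i) = (\<Sum>i\<in>I. genfun (W i))"
  using assms
proof (induction I rule: finite_induct)
  case empty
  then show ?case by (simp add: genfun_empty)
next
  case (insert i I)
  have "W i \<inter> (\<Union>j\<in>I. W j) = {}" using insert.prems insert.hyps by blast
  moreover have "genfun (\<Union>j\<in>I. W j) = (\<Sum>j\<in>I. genfun (W j))"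
    using insert.IH insert.prems by blast
  ultimately show ?case using insert.hyps by (simp add: genfun_Un_disjoint)
qed

lemma endpoint_append: "endpoint (u @ v) = endpoint u + endpoint v"
  by (simp add: endpoint_def)

definition concats :: "step list set \<Rightarrow> step list set \<Rightarrow> step list set" where
  "concats A B = (\<lambda>(u, v). u @ v) ` (A \<times> B)"

lemma concatsI: "u \<in> A \<Longrightarrow> v \<in> B \<Longrightarrow> u @ v \<in> concats A B"
  by (auto simp: concats_def)

lemma concatsE:
  assumes "w \<in> concats A B"
  obtains u v where "w = u @ v" "u \<in> A" "v \<in> B"
  using assms by (auto simp: concats_def)

text \<open>Lengths and endpoints are additive under concatenation, so the Cauchy product counts pairs
  of words; injectivity turns the pairs into concatenated words.\<close>

lemma genfun_mult:
  assumes inj: "inj_on (\<lambda>(u, v). u @ v) (A \<times> B)"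
  shows "genfun A * genfun B = genfun (concats A B)"
proof (rule fps_ext)
  fix m
  let ?L = "\<lambda>W i. {w. w \<in> W \<and> length w = i}"
  let ?mon = "\<lambda>w. Poly_Mapping.single (endpoint w) (1::int)"
  let ?P = "SIGMA i:{0..m}. ?L A i \<times> ?L B (m - i)"
  have "fps_nth (genfun A * genfun B) m =
      (\<Sum>i=0..m. (\<Sum>u\<in>?L A i. ?mon u) * (\<Sum>v\<in>?L B (m - i). ?mon v))"
    by (simp add: fps_mult_nth genfun_nth)
  also have "\<dots> = (\<Sum>i=0..m. \<Sum>(u, v)\<in>?L A i \<times> ?L B (m - i). ?mon (u @ v))"
    by (simp add: sum_product sum.cartesian_product mult_single endpoint_append)
  also have "\<dots> = (\<Sum>(i, u, v)\<in>?P. ?mon (u @ v))"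
    by (rule sum.Sigma) (auto intro: finite_walks_of_length)
  also have "\<dots> = (\<Sum>w\<in>?L (concats A B) m. ?mon w)"
  proof -
    have "bij_betw (\<lambda>(i, u, v). u @ v) ?P (?L (concats A B) m)"
      unfolding bij_betw_def
    proof
      show "inj_on (\<lambda>(i, u, v). u @ v) ?P"
      proof (rule inj_onI)
        fix p q
        assume pq: "p \<in> ?P" "q \<in> ?P" "(\<lambda>(i, u, v). u @ v) p = (\<lambda>(i, u, v). u @ v) q"
        obtain i u v j u' v' where [simp]: "p = (i, u, v)" "q = (j, u', v')"
          by (metis prod_cases3)
        have "(u, v) = (u', v')"
          by (rule inj_onD[OF inj]) (use pq in auto)
        then show "p = q" using pq by auto
      qed
      show "(\<lambda>(i, u, v). u @ v) ` ?P = ?L (concats A B) m"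
      proof (intro equalityI subsetI)
        fix w assume "w \<in> ?L (concats A B) m"
        then obtain u v where "w = u @ v" "u \<in> A" "v \<in> B" "length u + length v = m"
          by (auto elim: concatsE)
        then show "w \<in> (\<lambda>(i, u, v). u @ v) ` ?P"
          by (intro image_eqI[of _ _ "(length u, u, v)"]) auto
      qed (auto intro: concatsI)
    qed
    from sum.reindex_bij_betw[OF this, of ?mon] show ?thesis
      by (simp add: case_prod_unfold)
  qed
  finally show "fps_nth (genfun A * genfun B) m = fps_nth (genfun (concats A B)) m"
    by (simp add: genfun_nth)
qed

section \<open>Leaving the upper half plane\<close>

lemma in_upper_half_plane_Nil: "in_upper_half_plane []"
  by (simp add: in_upper_half_plane_def endpoint_def)

lemma in_upper_half_plane_snoc:
  "in_upper_half_plane (w @ [x]) \<longleftrightarrow> in_upper_half_plane w \<and> snd (endpoint (w @ [x])) \<ge> 0"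
  by (auto simp: in_upper_half_plane_def le_Suc_eq)

lemma in_upper_half_plane_prefix: "in_upper_half_plane (u @ v) \<Longrightarrow> in_upper_half_plane u"
  by (induction v rule: rev_induct) (simp_all add: in_upper_half_plane_snoc flip: append_assoc)

lemma not_in_upper_half_plane_exit:
  assumes "snd (endpoint u) = 0"
  shows "\<not> in_upper_half_plane (u @ South # v)"
proof
  assume "in_upper_half_plane (u @ South # v)"
  then have "in_upper_half_plane (u @ [South])"
    using in_upper_half_plane_prefix[of "u @ [South]" v] by simp
  then show False using assms by (simp add: in_upper_half_plane_snoc endpoint_append endpoint_def)
qed

lemma in_upper_half_plane_hd:
  assumes "in_upper_half_plane w" "w \<noteq> []"
  shows "hd w \<noteq> South"
  using assms not_in_upper_half_plane_exit[of "[]" "tl w"]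
  by (cases w) (auto simp: endpoint_def)

text \<open>Heights change by at most one per step, so the first visit below the axis is a south step
  from the axis.\<close>

lemma first_exit_decomposition:
  assumes "\<not> in_upper_half_plane w"
  obtains u v where "w = u @ South # v" "in_upper_half_plane u" "snd (endpoint u) = 0"
  using assms
proof (induction w arbitrary: thesis rule: rev_induct)
  case Nil
  then show ?case by (simp add: in_upper_half_plane_Nil)
next
  case (snoc x w)
  show ?case
  proof (cases "in_upper_half_plane w")
    case True
    then have "0 \<le> snd (endpoint w)"
      by (metis in_upper_half_plane_def order_refl take_all)
    moreover have "snd (endpoint w) + snd (step_vec x) < 0"
      using True snoc.prems(2) by (simp add: in_upper_half_plane_snoc endpoint_append endpoint_def)
    ultimately have "x = South \<and> snd (endpoint w) = 0" by (cases x) auto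
    then show ?thesis using True snoc.prems(1)[of w "[]"] by simp
  next
    case False
    then obtain u v where "w = u @ South # v" "in_upper_half_plane u" "snd (endpoint u) = 0"
      using snoc.IH by blast
    then show ?thesis using snoc.prems(1)[of u "v @ [x]"] by simp
  qed
qed

section \<open>Recovering the cut from a concatenation\<close>

text \<open>Two different cuts of one word differ by a nonempty overlap, which ends one of the left
  factors and begins one of the right factors.\<close>

lemma inj_on_append_no_overlap:
  assumes "\<And>u z v. z \<noteq> [] \<Longrightarrow> u \<in> A \<Longrightarrow> u @ z \<in> A \<Longrightarrow> v \<in> B \<Longrightarrow> z @ v \<in> B \<Longrightarrow> False"
  shows "inj_on (\<lambda>(u, v). u @ v) (A \<times> B)"
proof (rule inj_onI, clarify)
  fix u v u' v'
  assume "u \<in> A" "v \<in> B" "u' \<in> A" "v' \<in> B" and "u @ v = u' @ v'"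
  then show "u = u' \<and> v = v'"
    using assms by (auto simp: append_eq_append_conv2)
qed

text \<open>An overlap would end in \<open>\<theta>\<close> and thus put a second \<open>\<theta>\<close> into a word with only one.\<close>

lemma inj_on_append_only_at_end:
  assumes "\<And>u. u \<in> A \<Longrightarrow> last u = \<theta>" and "\<And>v. v \<in> B \<Longrightarrow> only_at_end \<theta> v"
  shows "inj_on (\<lambda>(u, v). u @ v) (A \<times> B)"
proof (rule inj_on_append_no_overlap)
  fix u z v
  assume "z \<noteq> []" "u @ z \<in> A" "v \<in> B" "z @ v \<in> B"
  then have "\<theta> \<in> set z" using assms(1)[of "u @ z"] last_in_set[of z] by simp
  then have "count_list z \<theta> \<noteq> 0" by (simp add: count_list_0_iff)
  then show False
    using assms(2)[OF \<open>v \<in> B\<close>] assms(2)[OF \<open>z @ v \<in> B\<close>] by (simp add: only_at_end_def)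
qed

text \<open>An overlap would start with a south step taken from the axis, inside a half plane walk.\<close>

lemma inj_on_append_first_exit:
  assumes "\<And>u. u \<in> A \<Longrightarrow> in_upper_half_plane u \<and> snd (endpoint u) = 0"
    and "\<And>v. v \<in> B \<Longrightarrow> hd v = South"
  shows "inj_on (\<lambda>(u, v). u @ v) (A \<times> B)"
proof (rule inj_on_append_no_overlap)
  fix u z v
  assume "z \<noteq> []" "u \<in> A" "u @ z \<in> A" "z @ v \<in> B"
  then have "z = South # tl z" using assms(2)[of "z @ v"] by (cases z) auto
  then show False
    using assms(1)[OF \<open>u \<in> A\<close>] assms(1)[OF \<open>u @ z \<in> A\<close>] not_in_upper_half_plane_exit by metis
qed

section \<open>The two ways of cutting a walk\<close>

lemma walks_append:
  assumes "u \<noteq> []" "v \<noteq> []"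
  shows "u @ v \<in> walks R \<longleftrightarrow> u \<in> walks R \<and> v \<in> walks R \<and> R (last u) (hd v)"
  using assms by (auto simp: walks_def successively_append_iff)

lemma only_at_end_iff: "only_at_end \<theta> w \<longleftrightarrow> (\<exists>z. w = z @ [\<theta>] \<and> \<theta> \<notin> set z)"
  by (cases w rule: rev_cases) (auto simp: only_at_end_def count_list_0_iff)

lemma only_at_end_append:
  assumes "v \<noteq> []"
  shows "only_at_end \<theta> (z @ v) \<longleftrightarrow> \<theta> \<notin> set z \<and> only_at_end \<theta> v"
  using assms by (cases v rule: rev_cases) (auto simp: only_at_end_iff)

lemma only_at_end_last: "only_at_end \<theta> w \<Longrightarrow> w \<noteq> [] \<and> last w = \<theta>"
  by (simp add: only_at_end_def)

context
  fixes R :: two_step_rule and \<theta> :: step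
begin

definition H_walks :: "step list set" where
  "H_walks = {w \<in> walks R. in_upper_half_plane w \<and> last w = \<theta>}"

definition B_walks :: "step list set" where
  "B_walks = {w \<in> walks R. hd w \<in> followers R \<theta> \<and> only_at_end \<theta> w}"

definition C_walks :: "step list set" where
  "C_walks = {w \<in> walks R. hd w \<noteq> South \<and> only_at_end \<theta> w}"

definition D_walks :: "step list set" where
  "D_walks = {w \<in> walks R. hd w = South \<and> only_at_end \<theta> w}"

definition S_walks :: "step list set" where
  "S_walks = {w \<in> walks R. in_upper_half_plane w \<and> R (last w) South \<and> snd (endpoint w) = 0}"

lemmas walk_class_defs = H_walks_def B_walks_def C_walks_def D_walks_def S_walks_def

text \<open>The last \<open>\<theta>\<close> before the end lies in \<open>u\<close>, if there is one, so the piece in front of the cut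
  inherits the half plane condition from \<open>u\<close>. The piece behind it may leave the half plane, as
  \<open>B\<^sub>\<theta>\<close> allows.\<close>

lemma cut_at_last_theta:
  assumes "u @ v \<in> walks R" "in_upper_half_plane u" "hd (u @ v) \<noteq> South" "only_at_end \<theta> v"
  shows "u @ v \<in> C_walks \<union> concats H_walks B_walks"
proof (cases "\<theta> \<in> set u")
  case False
  then have "only_at_end \<theta> (u @ v)" using assms(4) by (auto simp: only_at_end_iff)
  then show ?thesis using assms by (simp add: C_walks_def)
next
  case True
  then obtain p z where u: "u = p @ \<theta> # z" and z: "\<theta> \<notin> set z" by (metis split_list_last)
  have v: "v \<noteq> []" using assms(4) by (simp add: only_at_end_def)
  have split: "u @ v = (p @ [\<theta>]) @ (z @ v)" by (simp add: u)
  have w: "p @ [\<theta>] \<in> walks R" "z @ v \<in> walks R" "R \<theta> (hd (z @ v))"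
    using assms(1) v walks_append[of "p @ [\<theta>]" "z @ v" R] unfolding split by auto
  have "in_upper_half_plane (p @ [\<theta>])"
    using assms(2) in_upper_half_plane_prefix[of "p @ [\<theta>]" z] by (simp add: u)
  then have "p @ [\<theta>] \<in> H_walks" using w by (simp add: H_walks_def)
  moreover have "z @ v \<in> B_walks"
    using w v z assms(4) by (simp add: B_walks_def followers_def only_at_end_append)
  ultimately show ?thesis unfolding split by (blast intro: concatsI)
qed

text \<open>The first exit cannot happen inside \<open>u\<close>, so the piece behind the cut is a suffix of \<open>v\<close> and
  inherits from it that \<open>\<theta>\<close> occurs only at the end.\<close>

lemma cut_at_first_exit:
  assumes "u @ v \<in> walks R" "in_upper_half_plane u" "hd (u @ v) \<noteq> South" "only_at_end \<theta> v"
  shows "u @ v \<in> H_walks \<union> concats S_walks D_walks"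
proof (cases "in_upper_half_plane (u @ v)")
  case True
  then show ?thesis using assms only_at_end_last[OF assms(4)] by (simp add: H_walks_def)
next
  case False
  then obtain p q where pq: "u @ v = p @ South # q" "in_upper_half_plane p" "snd (endpoint p) = 0"
    by (rule first_exit_decomposition)
  have "\<exists>z. p = u @ z \<and> v = z @ South # q"
  proof -
    have "\<not> (\<exists>z. z \<noteq> [] \<and> u = p @ z \<and> z @ v = South # q)"
    proof
      assume "\<exists>z. z \<noteq> [] \<and> u = p @ z \<and> z @ v = South # q"
      then obtain z where "u = p @ South # z" by (metis Cons_eq_append_conv)
      then show False using assms(2) pq(3) not_in_upper_half_plane_exit by blast
    qed
    then show ?thesis using pq(1) by (auto simp: append_eq_append_conv2)
  qed
  then have D: "only_at_end \<theta> (South # q)" using assms(4) by (auto simp: only_at_end_append)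
  have "p \<noteq> []" using pq(1) assms(3) by auto
  then have "p \<in> walks R" "South # q \<in> walks R" "R (last p) South"
    using assms(1) walks_append[of p "South # q" R] by (simp_all add: pq(1))
  then have "p \<in> S_walks" "South # q \<in> D_walks" using pq D by (simp_all add: S_walks_def D_walks_def)
  then show ?thesis unfolding pq(1) by (blast intro: concatsI)
qed

text \<open>Each of the four classes consists of words \<open>u @ v\<close> to which both cuts apply: take for \<open>u\<close>
  the empty word, the left factor, or the walk without its last step.\<close>

lemma cut_identity: "C_walks \<union> concats H_walks B_walks = H_walks \<union> concats S_walks D_walks"
proof (intro equalityI subsetI)
  fix w
  assume "w \<in> C_walks \<union> concats H_walks B_walks"
  then show "w \<in> H_walks \<union> concats S_walks D_walks"
  proof
    assume "w \<in> C_walks"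
    then show ?thesis
      using cut_at_first_exit[of "[]" w] by (simp add: C_walks_def in_upper_half_plane_Nil)
  next
    assume "w \<in> concats H_walks B_walks"
    then obtain u v where w: "w = u @ v" and u: "u \<in> H_walks" and v: "v \<in> B_walks"
      by (rule concatsE)
    have ne: "u \<noteq> []" "v \<noteq> []" using u v by (auto simp: walk_class_defs walks_def)
    have "u @ v \<in> walks R"
      using u v ne by (simp add: walks_append H_walks_def B_walks_def followers_def)
    moreover have "hd (u @ v) \<noteq> South"
      using u ne in_upper_half_plane_hd[of u] by (simp add: H_walks_def)
    ultimately show ?thesis
      unfolding w using u v cut_at_first_exit by (simp add: H_walks_def B_walks_def)
  qed
next
  fix w
  assume "w \<in> H_walks \<union> concats S_walks D_walks"
  then show "w \<in> C_walks \<union> concats H_walks B_walks"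
  proof
    assume H: "w \<in> H_walks"
    then have ne: "w \<noteq> []" by (auto simp: H_walks_def walks_def)
    then have w: "w = butlast w @ [\<theta>]" using H by (auto simp: H_walks_def)
    have "in_upper_half_plane (butlast w)"
      using H w in_upper_half_plane_prefix by (metis (no_types, lifting) H_walks_def mem_Collect_eq)
    moreover have "hd w \<noteq> South" using H ne in_upper_half_plane_hd[of w] by (simp add: H_walks_def)
    moreover have "only_at_end \<theta> [\<theta>]" by (simp add: only_at_end_def)
    ultimately show ?thesis
      using H w cut_at_last_theta[of "butlast w" "[\<theta>]"] by (simp add: H_walks_def)
  next
    assume "w \<in> concats S_walks D_walks"
    then obtain u v where w: "w = u @ v" and u: "u \<in> S_walks" and v: "v \<in> D_walks"
      by (rule concatsE)
    have ne: "u \<noteq> []" "v \<noteq> []" using u v by (auto simp: walk_class_defs walks_def)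
    have "u @ v \<in> walks R" using u v ne by (simp add: walks_append S_walks_def D_walks_def)
    moreover have "hd (u @ v) \<noteq> South"
      using u ne in_upper_half_plane_hd[of u] by (simp add: S_walks_def)
    ultimately show ?thesis
      unfolding w using u v cut_at_last_theta by (simp add: S_walks_def D_walks_def)
  qed
qed

text \<open>The left factor contributes a \<open>\<theta>\<close> before the final one.\<close>

lemma C_walks_disjoint: "C_walks \<inter> concats H_walks B_walks = {}"
proof -
  have "w \<notin> C_walks" if "w \<in> concats H_walks B_walks" for w
    using that
  proof (rule concatsE)
    fix u v
    assume w: "w = u @ v" and u: "u \<in> H_walks" and v: "v \<in> B_walks"
    have "\<theta> \<in> set u" using u last_in_set[of u] by (auto simp: H_walks_def walks_def)
    moreover have "v \<noteq> []" using v by (auto simp: B_walks_def walks_def)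
    ultimately show "w \<notin> C_walks" by (simp add: w C_walks_def only_at_end_append)
  qed
  then show ?thesis by blast
qed

lemma H_walks_disjoint: "H_walks \<inter> concats S_walks D_walks = {}"
proof -
  have "w \<notin> H_walks" if "w \<in> concats S_walks D_walks" for w
    using that
  proof (rule concatsE)
    fix u v
    assume w: "w = u @ v" and u: "u \<in> S_walks" and v: "v \<in> D_walks"
    have "v = South # tl v" using v by (cases v) (auto simp: D_walks_def walks_def)
    then have "\<not> in_upper_half_plane (u @ v)"
      using u not_in_upper_half_plane_exit[of u "tl v"] by (simp add: S_walks_def)
    then show "w \<notin> H_walks" by (simp add: w H_walks_def)
  qed
  then show ?thesis by blast
qed

lemma genfun_cut_identity:
  "genfun C_walks + genfun H_walks * genfun B_walks =
   genfun H_walks + genfun S_walks * genfun D_walks"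
proof -
  have "genfun H_walks * genfun B_walks = genfun (concats H_walks B_walks)"
    by (intro genfun_mult inj_on_append_only_at_end[of _ \<theta>]) (auto simp: walk_class_defs)
  moreover have "genfun S_walks * genfun D_walks = genfun (concats S_walks D_walks)"
    by (intro genfun_mult inj_on_append_first_exit) (auto simp: walk_class_defs)
  ultimately show ?thesis
    by (simp add: cut_identity C_walks_disjoint H_walks_disjoint flip: genfun_Un_disjoint)
qed

end

section \<open>The functional equation\<close>

lemma Hstar_gf_eq_genfun:
  "Hstar_gf R = genfun {w \<in> walks R. in_upper_half_plane w \<and> R (last w) South}"
proof -
  have "Hstar_gf R = genfun (\<Union>\<phi>\<in>predecessors R South.
      {w \<in> walks R. in_upper_half_plane w \<and> last w = \<phi>})"
    unfolding Hstar_gf_def H_gf_def by (rule genfun_UN_disjoint[symmetric]) auto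
  also have "(\<Union>\<phi>\<in>predecessors R South. {w \<in> walks R. in_upper_half_plane w \<and> last w = \<phi>}) =
      {w \<in> walks R. in_upper_half_plane w \<and> R (last w) South}"
    by (auto simp: predecessors_def)
  finally show ?thesis .
qed

theorem theorem2:
  fixes R :: two_step_rule
  assumes "aperiodic R"
  shows "(\<forall>\<theta>. H_gf R \<theta> =
             C_gf R \<theta> + B_gf R \<theta> * H_gf R \<theta> - D_gf R \<theta> * eval_y0 (Hstar_gf R)) \<and>
         Hstar_gf R = genfun {w \<in> walks R. in_upper_half_plane w \<and> R (last w) South}"
proof (intro conjI allI)
  fix \<theta>
  have "eval_y0 (Hstar_gf R) = genfun (S_walks R)"
    by (simp add: Hstar_gf_eq_genfun eval_y0_genfun S_walks_def)
  moreover have "H_gf R \<theta> = genfun (H_walks R \<theta>)" "B_gf R \<theta> = genfun (B_walks R \<theta>)"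
      "C_gf R \<theta> = genfun (C_walks R \<theta>)" "D_gf R \<theta> = genfun (D_walks R \<theta>)"
    by (simp_all add: H_gf_def B_gf_def C_gf_def D_gf_def walk_class_defs)
  ultimately show "H_gf R \<theta> =
      C_gf R \<theta> + B_gf R \<theta> * H_gf R \<theta> - D_gf R \<theta> * eval_y0 (Hstar_gf R)"
    using genfun_cut_identity[of R \<theta>] by (simp add: algebra_simps)
qed (rule Hstar_gf_eq_genfun)

end
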